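(* Let $p\in\{1,2,\dots\}\cup\{\infty\}$, let $f\in A(D)$ and define $g:(0,1)\to\mathbb{C}$ by $g(t)=f(e^{it})$. Then $f^{(l)}$ extends continuously to $D\cup\{e^{i\theta}:0<\theta<1\}$ for all $l\in\{0,1,2,\dots\}$ with $l\le p$ if and only if $g\in C^p((0,1))$. In that case, for all $t\in(0,1)$, $$\frac{dg}{dt}(t)=ie^{it}f'(e^{it}),$$ where $f'(e^{it})$ denotes the value at $e^{it}$ of the continuous extension of $f'$.
   Context: $D$ is the open unit disk in $\mathbb{C}$. $A(D)$ is the set of functions $f:\overline{D}\to\mathbb{C}$ that are continuous on $\overline{D}$ and holomorphic in $D$. $f^{(l)}$ denotes the $l$-th complex derivative of $f$ in $D$. $C^p((0,1))$ is the set of complex-valued functions of class $C^p$ on the real interval $(0,1)$. *)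

theory Defs
  imports "HOL-Analysis.Analysis" "HOL-Library.Extended_Nat"
begin

definition disc_algebra :: "(complex \<Rightarrow> complex) set" where
  "disc_algebra = {f. continuous_on (cball 0 1) f \<and> f holomorphic_on ball 0 1}"

text \<open>Intended for open \<open>S\<close>: the derivatives are two-sided, so on an open set they depend
  only on the restriction of \<open>g\<close> to \<open>S\<close>. The case \<open>p = \<infinity>\<close> is \<open>C\<^sup>\<infinity>\<close>.
  Differentiability is demanded explicitly because \<^const>\<open>vector_derivative\<close> is an
  arbitrary value where no derivative exists.\<close>

definition C_on :: "enat \<Rightarrow> real set \<Rightarrow> (real \<Rightarrow> complex) \<Rightarrow> bool" where
  "C_on p S g \<longleftrightarrow>
     (\<forall>k. enat k < p \<longrightarrow>
        (\<forall>t\<in>S. ((\<lambda>h t. vector_derivative h (at t)) ^^ k) g differentiable (at t))) \<and>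
     (\<forall>k. enat k \<le> p \<longrightarrow>
        continuous_on S (((\<lambda>h t. vector_derivative h (at t)) ^^ k) g))"

definition continuous_extension ::
  "'a::topological_space set \<Rightarrow> ('a \<Rightarrow> 'b::topological_space) \<Rightarrow> 'a set \<Rightarrow> ('a \<Rightarrow> 'b) \<Rightarrow> bool" where
  "continuous_extension D h E F \<longleftrightarrow> D \<subseteq> E \<and> continuous_on E F \<and> (\<forall>z\<in>D. F z = h z)"

definition disc_with_arc :: "complex set" where
  "disc_with_arc = ball 0 1 \<union> cis ` {0<..<1}"

end

theory Submission
  imports Defs "HOL-Complex_Analysis.Complex_Analysis"
begin

text \<open>
  The heart of the matter is local: if \<open>h\<close> is holomorphic in the disc, continuous up to the
  arc, and \<open>C\<^sup>1\<close> along the arc, then \<open>h'\<close> extends continuously to the arc. With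
  \<open>K(w) = h(e\<^bsup>iw\<^esup>)\<close> this concerns a half-strip with its edge on the real axis. The
  horizontal difference quotients of \<open>K\<close> converge uniformly to \<open>K'\<close> on compact pieces of the
  edge (there because \<open>K\<close> is \<open>C\<^sup>1\<close>) and of the interior. On the vertical sides of a
  rectangle standing on the edge \<open>[a, b]\<close> they are, by Cauchy's estimate, only \<open>O(1/Im w)\<close>;
  the factor \<open>((w - a)(w - b))\<^sup>2 = O((Im w)\<^sup>2)\<close> absorbs this. Hence the quotients times this
  factor converge uniformly on the boundary of the rectangle, so by the maximum modulus principle
  on all of it, and their limit is continuous.

  Conversely, if \<open>h\<close> and \<open>h'\<close> both extend continuously to the (convex) set disc-with-arc, the
  extension of \<open>h\<close> is differentiable there, relative to that set, with derivative the extension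
  of \<open>h'\<close>, and the chain rule gives the formula for \<open>dg/dt\<close>. Replacing \<open>h\<close> by \<open>h'\<close> costs one
  order of smoothness on either side, so induction on the order proves the equivalence.
\<close>

section \<open>Uniform convergence and horizontal difference quotients\<close>

text \<open>The maximum modulus principle, applied to the differences \<open>f m - f n\<close>,
  carries the uniform Cauchy property from the frontier to all of \<open>S\<close>. The limit off
  the frontier is left open and has to be identified separately.\<close>

lemma uniformly_convergent_on_of_frontier:
  fixes f :: "nat \<Rightarrow> complex \<Rightarrow> complex"
  assumes S: "compact S"
    and cont: "\<And>n. continuous_on S (f n)"
    and hol: "\<And>n. f n holomorphic_on interior S"
    and lim: "uniform_limit (frontier S) f l sequentially"
  shows "uniformly_convergent_on S f"
proof (intro Cauchy_uniformly_convergent uniformly_Cauchy_onI)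
  fix e :: real assume "e > 0"
  have "uniformly_Cauchy_on (frontier S) f"
    using lim by (intro uniformly_convergent_Cauchy) (auto simp: uniformly_convergent_on_def)
  then obtain M where M: "\<And>w m n. w \<in> frontier S \<Longrightarrow> m \<ge> M \<Longrightarrow> n \<ge> M \<Longrightarrow> dist (f m w) (f n w) < e / 2"
    using \<open>e > 0\<close> unfolding uniformly_Cauchy_on_def by (metis half_gt_zero)
  have "dist (f m w) (f n w) < e" if "w \<in> S" "m \<ge> M" "n \<ge> M" for w m n
  proof -
    have "norm (f m w - f n w) \<le> e / 2"
    proof (rule maximum_modulus_frontier[where S = S and f = "\<lambda>w. f m w - f n w"])
      show "continuous_on (closure S) (\<lambda>w. f m w - f n w)"
        using S cont by (auto intro!: continuous_intros simp: compact_imp_closed)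
      show "norm (f m z - f n z) \<le> e / 2" if "z \<in> frontier S" for z
        using M[OF that \<open>m \<ge> M\<close> \<open>n \<ge> M\<close>] by (simp add: dist_norm)
    qed (use S hol that in \<open>auto intro!: holomorphic_intros compact_imp_bounded\<close>)
    then show ?thesis
      using \<open>e > 0\<close> by (simp add: dist_norm)
  qed
  then show "\<exists>M. \<forall>w\<in>S. \<forall>m\<ge>M. \<forall>n\<ge>M. dist (f m w) (f n w) < e"
    by blast
qed

text \<open>Mean value inequality along the segment from \<open>w\<close> to \<open>w + s\<close>.
  Only the derivative in the horizontal direction enters, so the lemma serves on the real edge as
  well as above it.\<close>

lemma horizontal_quotient_bound:
  fixes K K1 :: "complex \<Rightarrow> complex" and s :: real
  assumes s: "s > 0"
    and der: "\<And>x. x \<in> {Re w..Re w + s} \<Longrightarrow>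
      ((\<lambda>x. K (Complex x (Im w))) has_vector_derivative K1 (Complex x (Im w))) (at x)"
    and bd: "\<And>x. x \<in> {Re w..Re w + s} \<Longrightarrow> norm (K1 (Complex x (Im w)) - K1 w) \<le> e"
  shows "norm ((K (w + of_real s) - K w) / of_real s - K1 w) \<le> e"
proof -
  let ?k = "\<lambda>x. K (Complex x (Im w))"
  have "norm (?k (Re w + s) - ?k (Re w) - ((Re w + s) - Re w) *\<^sub>R K1 (Complex (Re w) (Im w)))
      \<le> norm ((Re w + s) - Re w) * e"
    by (rule vector_differentiable_bound_linearization[where S = "{Re w..Re w + s}"
          and f' = "\<lambda>x. K1 (Complex x (Im w))"])
      (use s in \<open>auto simp: closed_segment_eq_real_ivl bd intro!: has_vector_derivative_at_within[OF der]\<close>)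
  moreover have "Complex (Re w + s) (Im w) = w + of_real s"
    by (simp add: complex_eq_iff)
  ultimately have "norm (K (w + of_real s) - K w - of_real s * K1 w) \<le> s * e"
    using s by (simp add: scaleR_conv_of_real)
  moreover have "(K (w + of_real s) - K w) / of_real s - K1 w
      = (K (w + of_real s) - K w - of_real s * K1 w) / of_real s"
    using s by (simp add: field_simps)
  ultimately show ?thesis
    using s by (simp add: norm_divide field_simps)
qed

text \<open>Uniform continuity of \<open>K1\<close> on the compact set \<open>X\<close> bounds its
  oscillation over segments of length \<open>s n\<close>. These segments may leave \<open>C\<close>
  to the right, hence the larger set \<open>X\<close>.\<close>

lemma uniform_limit_horizontal_quotient:
  fixes K K1 :: "complex \<Rightarrow> complex" and s :: "nat \<Rightarrow> real"
  assumes X: "compact X" and cont: "continuous_on X K1"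
    and CX: "\<And>w n \<sigma>. w \<in> C \<Longrightarrow> \<sigma> \<in> {0..s n} \<Longrightarrow> w + of_real \<sigma> \<in> X"
    and der: "\<And>w. w \<in> X \<Longrightarrow> ((\<lambda>x. K (Complex x (Im w))) has_vector_derivative K1 w) (at (Re w))"
    and s: "\<And>n. s n > 0" "s \<longlonglongrightarrow> 0"
  shows "uniform_limit C (\<lambda>n w. (K (w + of_real (s n)) - K w) / of_real (s n)) K1 sequentially"
proof (rule uniform_limitI)
  fix e :: real assume e: "e > 0"
  have "uniformly_continuous_on X K1"
    using compact_uniformly_continuous[OF cont X] .
  then obtain d where d: "d > 0"
    "\<And>w w'. w \<in> X \<Longrightarrow> w' \<in> X \<Longrightarrow> dist w' w < d \<Longrightarrow> dist (K1 w') (K1 w) < e / 2"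
    unfolding uniformly_continuous_on_def using e by (meson half_gt_zero)
  have "\<forall>\<^sub>F n in sequentially. s n < d"
    using s(2) d(1) by (auto dest: order_tendstoD)
  then show "\<forall>\<^sub>F n in sequentially. \<forall>w\<in>C. dist ((K (w + of_real (s n)) - K w) / of_real (s n)) (K1 w) < e"
  proof eventually_elim
    case (elim n)
    show ?case
    proof
      fix w assume w: "w \<in> C"
      have inX: "Complex x (Im w) \<in> X" if "x \<in> {Re w..Re w + s n}" for x
      proof -
        have "Complex x (Im w) = w + of_real (x - Re w)"
          by (simp add: complex_eq_iff)
        then show ?thesis
          using CX[OF w, of "x - Re w" n] that by simp
      qed
      have "norm ((K (w + of_real (s n)) - K w) / of_real (s n) - K1 w) \<le> e / 2"
      proof (rule horizontal_quotient_bound[OF s(1)])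
        fix x assume x: "x \<in> {Re w..Re w + s n}"
        show "((\<lambda>x. K (Complex x (Im w))) has_vector_derivative K1 (Complex x (Im w))) (at x)"
          using der[OF inX[OF x]] by simp
        have "w \<in> X" using CX[OF w, of 0 n] s(1)[of n] by simp
        moreover have "Complex x (Im w) - w = of_real (x - Re w)"
          by (simp add: complex_eq_iff)
        then have "dist (Complex x (Im w)) w < d"
          using x elim by (simp only: dist_norm norm_of_real) auto
        ultimately show "norm (K1 (Complex x (Im w)) - K1 w) \<le> e / 2"
          using d(2)[OF _ inX[OF x]] by (simp add: dist_norm less_imp_le)
      qed
      then show "dist ((K (w + of_real (s n)) - K w) / of_real (s n)) (K1 w) < e"
        using e by (simp add: dist_norm)
    qed
  qed
qed

text \<open>Cauchy's estimate on a disc about \<open>w\<close> of radius proportional to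
  \<open>Im w\<close>, with \<open>K\<close> bounded on a slightly larger compact box.\<close>

lemma derivative_bound_near_edge:
  fixes K :: "complex \<Rightarrow> complex"
  assumes ab: "\<alpha> < a" "a \<le> b" "b < \<beta>"
    and cont: "continuous_on {w. \<alpha> < Re w \<and> Re w < \<beta> \<and> 0 \<le> Im w} K"
    and der: "\<And>w. \<alpha> < Re w \<Longrightarrow> Re w < \<beta> \<Longrightarrow> 0 < Im w \<Longrightarrow> (K has_field_derivative K1 w) (at w)"
  obtains B where "B > 0" "\<And>w. a \<le> Re w \<Longrightarrow> Re w \<le> b \<Longrightarrow> 0 < Im w \<Longrightarrow> Im w \<le> 1 \<Longrightarrow> norm (K1 w) \<le> B / Im w"
proof -
  \<comment> \<open>The box widened by \<kappa> stays inside the strip. As \<kappa> < 1, the disc of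
    radius \<open>\<kappa> * Im w\<close> misses the real axis and stays below height 2.\<close>
  define \<kappa> where "\<kappa> = min (min (a - \<alpha>) (\<beta> - b)) 1 / 2"
  have \<kappa>: "\<kappa> > 0" "\<alpha> < a - \<kappa>" "b + \<kappa> < \<beta>" "\<kappa> < 1"
    using ab by (auto simp: \<kappa>_def min_def field_simps)
  define R where "R = cbox (Complex (a - \<kappa>) 0) (Complex (b + \<kappa>) 2)"
  have "R \<subseteq> {w. \<alpha> < Re w \<and> Re w < \<beta> \<and> 0 \<le> Im w}"
    using \<kappa> by (auto simp: R_def in_cbox_complex_iff)
  then have "compact (K ` R)"
    by (intro compact_continuous_image continuous_on_subset[OF cont]) (simp_all add: R_def)
  then have "bounded (K ` R)" by (rule compact_imp_bounded)
  then obtain B where B: "B > 0" "\<And>w. w \<in> R \<Longrightarrow> norm (K w) \<le> B"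
    by (auto simp: bounded_pos)
  have "norm (K1 w) \<le> B / \<kappa> / Im w" if w: "a \<le> Re w" "Re w \<le> b" "0 < Im w" "Im w \<le> 1" for w
  proof -
    define r where "r = \<kappa> * Im w"
    have r: "r > 0" "r \<le> \<kappa>" "r < Im w"
      using \<kappa> w by (auto simp: r_def mult_left_le)
    have sub: "\<bar>Re z - Re w\<bar> \<le> r \<and> \<bar>Im z - Im w\<bar> \<le> r" if "z \<in> cball w r" for z
      using that abs_Re_le_cmod[of "w - z"] abs_Im_le_cmod[of "w - z"] by (auto simp: dist_norm)
    have box: "\<alpha> < Re z \<and> Re z < \<beta> \<and> 0 < Im z \<and> z \<in> R" if "z \<in> cball w r" for z
      using sub[OF that] r w \<kappa> by (auto simp: R_def in_cbox_complex_iff abs_le_iff)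
    have "norm ((deriv ^^ 1) K w) \<le> fact 1 * B / r ^ 1"
    proof (rule Cauchy_inequality)
      show "K holomorphic_on ball w r"
        using box by (auto simp: holomorphic_on_open intro!: exI der)
      show "continuous_on (cball w r) K"
        using box by (intro continuous_on_subset[OF cont]) (force simp: less_imp_le)
      show "norm (K z) \<le> B" if "norm (w - z) = r" for z
        using that box[of z] by (intro B) (auto simp: dist_norm)
    qed (use r in auto)
    moreover have "deriv K w = K1 w"
      using box[of w] r by (intro DERIV_imp_deriv der) auto
    ultimately show ?thesis
      by (simp add: r_def field_simps)
  qed
  then show thesis
    using that[of "B / \<kappa>"] B \<kappa> by simp
qed

section \<open>Continuity of the derivative up to the edge of a half-strip\<close>

text \<open>\<open>K1\<close> joins two kinds of derivative, the complex one above the real axis and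
  the one along the axis on it; the point is that they fit together.\<close>

proposition continuous_on_strip_derivative:
  fixes K K1 :: "complex \<Rightarrow> complex"
  assumes cont: "continuous_on {w. \<alpha> < Re w \<and> Re w < \<beta> \<and> 0 \<le> Im w} K"
    and der: "\<And>w. \<alpha> < Re w \<Longrightarrow> Re w < \<beta> \<Longrightarrow> 0 < Im w \<Longrightarrow> (K has_field_derivative K1 w) (at w)"
    and bdy: "\<And>t. \<alpha> < t \<Longrightarrow> t < \<beta> \<Longrightarrow>
      ((\<lambda>x. K (of_real x)) has_vector_derivative K1 (of_real t)) (at t)"
    and cont_bdy: "continuous_on {\<alpha><..<\<beta>} (\<lambda>t. K1 (of_real t))"
  shows "continuous_on {w. \<alpha> < Re w \<and> Re w < \<beta> \<and> 0 \<le> Im w} K1"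
proof -
  define U where "U = {w. \<alpha> < Re w \<and> Re w < \<beta> \<and> 0 \<le> Im w}"
  define V where "V = {w. \<alpha> < Re w \<and> Re w < \<beta> \<and> 0 < Im w}"
  have "open V"
    unfolding V_def by (intro open_Collect_conj open_Collect_less continuous_intros)
  have holK: "K holomorphic_on V"
    using \<open>open V\<close> by (auto simp: V_def holomorphic_on_open intro!: exI der)
  have "deriv K holomorphic_on V"
    using holK \<open>open V\<close> by (rule holomorphic_deriv)
  then have "continuous_on V (deriv K)"
    by (rule holomorphic_on_imp_continuous_on)
  then have contV: "continuous_on V K1"
    by (rule continuous_on_eq) (auto simp: V_def intro!: DERIV_imp_deriv der)
  \<comment> \<open>Both kinds of derivative are horizontal derivatives, which puts edge and
    interior on the same footing.\<close>
  have hder: "((\<lambda>x. K (Complex x (Im w))) has_vector_derivative K1 w) (at (Re w))" if "w \<in> U" for w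
  proof (cases "Im w = 0")
    case True
    then have "of_real (Re w) = w" by (simp add: complex_eq_iff)
    then show ?thesis
      using bdy[of "Re w"] that True by (simp add: U_def complex_of_real_def)
  next
    case False
    have "((\<lambda>x. of_real x + \<i> * of_real (Im w)) has_vector_derivative 1) (at (Re w))"
      by (auto intro!: derivative_eq_intros)
    then have "((\<lambda>x. Complex x (Im w)) has_vector_derivative 1) (at (Re w))"
      by (simp add: Complex_eq)
    from field_vector_diff_chain_at[OF this] show ?thesis
      using der[of w] that False by (simp add: U_def o_def)
  qed
  have box_cont: "continuous_on (cbox (Complex a 0) (Complex b 1)) (\<lambda>w. ((w - of_real a) * (w - of_real b))^2 * K1 w)"
    if ab: "\<alpha> < a" "a < b" "b < \<beta>" for a b
  proof -
    define R where "R = cbox (Complex a 0) (Complex b 1)"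
    \<comment> \<open>\<open>P\<close> vanishes to second order at the two corners on the real axis, where the bound
      \<open>B / Im w\<close> on the difference quotients degenerates.\<close>
    define P where "P = (\<lambda>w. ((w - of_real a) * (w - of_real b))^2 :: complex)"
    \<comment> \<open>Room to the right of \<open>b\<close>: the shifts \<open>s n\<close> are at
      most \<eta>, so points of \<open>R\<close> moved by them stay in the strip.\<close>
    define \<eta> where "\<eta> = (\<beta> - b) / 2"
    have \<eta>: "\<eta> > 0" "b + \<eta> < \<beta>" using ab by (auto simp: \<eta>_def field_simps)
    define s where "s = (\<lambda>n. \<eta> * inverse (real (Suc n)))"
    have s: "\<And>n. s n > 0" "s \<longlonglongrightarrow> 0" "\<And>n. s n \<le> \<eta>"
      using \<eta> tendsto_mult_right_zero[OF LIMSEQ_inverse_real_of_nat, of \<eta>]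
      by (auto simp: s_def field_simps)
    define Q where "Q = (\<lambda>n w. (K (w + of_real (s n)) - K w) / of_real (s n))"
    have RU: "w + of_real \<sigma> \<in> U" if "w \<in> R" "\<sigma> \<in> {0..s n}" for w n \<sigma>
      using that ab \<eta> s(3)[of n] by (auto simp: R_def U_def in_cbox_complex_iff)
    obtain B where B: "B > 0"
      "\<And>w. a \<le> Re w \<Longrightarrow> Re w \<le> b + \<eta> \<Longrightarrow> 0 < Im w \<Longrightarrow> Im w \<le> 1 \<Longrightarrow> norm (K1 w) \<le> B / Im w"
      using derivative_bound_near_edge[OF _ _ _ cont der, of a "b + \<eta>"] ab \<eta> by auto
    define c where "c = b - a + 1"
    have c: "c \<ge> 1" using ab by (simp add: c_def)
    have factor_le: "norm (w - of_real a) \<le> c \<and> norm (w - of_real b) \<le> c" if "w \<in> R" for w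
      using that cmod_le[of "w - of_real a"] cmod_le[of "w - of_real b"]
      by (auto simp: R_def c_def in_cbox_complex_iff)
    have P_le: "norm (P w) \<le> c^4" if "w \<in> R" for w
    proof -
      have "norm (P w) \<le> (c * c)^2"
        unfolding P_def norm_power norm_mult using factor_le[OF that] c
        by (intro power_mono mult_mono) auto
      then show ?thesis by (simp add: power2_eq_square power4_eq_xxxx)
    qed
    \<comment> \<open>On a vertical side one of the two linear factors has modulus exactly
      \<open>Im w\<close>; the other is at most \<open>c\<close>.\<close>
    have P_side: "norm (P w) \<le> (c * Im w)^2" if "w \<in> R" "Re w = a \<or> Re w = b" for w
    proof -
      have "norm (w - of_real (Re w)) = Im w"
        using that(1) by (simp add: R_def in_cbox_complex_iff cmod_def)
      moreover have "0 \<le> Im w"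
        using that(1) by (simp add: R_def in_cbox_complex_iff)
      ultimately have "norm (w - of_real a) * norm (w - of_real b) \<le> c * Im w"
        using that(2) factor_le[OF that(1)]
        by (metis mult.commute mult_left_mono mult_right_mono)
      then show ?thesis
        unfolding P_def norm_power norm_mult by (intro power_mono) auto
    qed
    \<comment> \<open>The segment from \<open>w\<close> to \<open>w + s n\<close> runs at constant
      height, so \<open>B / Im w\<close> bounds \<open>K1\<close> at all its points.\<close>
    have Q_near: "norm (Q n w - K1 w) \<le> 2 * B / Im w" if "w \<in> R" "Im w > 0" for n w
      unfolding Q_def
    proof (rule horizontal_quotient_bound[OF s(1)])
      fix x assume x: "x \<in> {Re w..Re w + s n}"
      let ?z = "Complex x (Im w)"
      have z: "a \<le> x" "x \<le> b + \<eta>" "Im w \<le> 1" "Re w \<le> b" "a \<le> Re w"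
        using x s(3)[of n] that by (auto simp: R_def in_cbox_complex_iff)
      show "((\<lambda>x. K (Complex x (Im w))) has_vector_derivative K1 ?z) (at x)"
        using hder[of ?z] z ab \<eta> that by (simp add: U_def)
      have "norm (K1 ?z - K1 w) \<le> norm (K1 ?z) + norm (K1 w)"
        by (rule norm_triangle_ineq4)
      also have "\<dots> \<le> B / Im w + B / Im w"
        using B(2)[of ?z] B(2)[of w] z that \<eta> by (intro add_mono) auto
      finally show "norm (K1 ?z - K1 w) \<le> 2 * B / Im w" by simp
    qed
    have lim_frontier: "uniform_limit (frontier R) (\<lambda>n w. P w * Q n w) (\<lambda>w. P w * K1 w) sequentially"
    proof (rule uniform_limitI)
      fix e :: real assume e: "e > 0"
      \<comment> \<open>The frontier splits into the bottom edge, the points of height at least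
        \<delta>, and the low parts of the sides. On the last the error is at most
        \<open>2 * c^2 * B * Im w\<close>, which the choice of \<delta> keeps below
        \<open>e\<close>. Since \<delta> is at most 1, the top edge falls under the second
        case.\<close>
      define \<delta> where "\<delta> = min 1 (e / (4 * c^2 * B))"
      have \<delta>: "\<delta> > 0" "\<delta> \<le> 1" "2 * c^2 * B * \<delta> < e"
      proof -
        have pos: "c^2 * B > 0" using c B by simp
        then show "\<delta> > 0" "\<delta> \<le> 1" using e by (auto simp: \<delta>_def mult.assoc intro!: divide_pos_pos)
        have "2 * c^2 * B * \<delta> \<le> 2 * c^2 * B * (e / (4 * c^2 * B))"
          using B(1) by (intro mult_left_mono) (auto simp: \<delta>_def)
        also have "\<dots> = e / 2" using B(1) c by (simp add: field_simps)
        finally show "2 * c^2 * B * \<delta> < e" using e by simp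
      qed
      have "uniform_limit {w \<in> R. Im w = 0} Q K1 sequentially"
        unfolding Q_def
      proof (rule uniform_limit_horizontal_quotient[where X = "complex_of_real ` {a..b + \<eta>}"])
        show "compact (complex_of_real ` {a..b + \<eta>})"
          by (intro compact_continuous_image continuous_intros) auto
        have "continuous_on {a..b + \<eta>} (\<lambda>t. K1 (of_real t))"
          using ab \<eta> by (intro continuous_on_subset[OF cont_bdy]) auto
        then have "continuous_on (Re ` (complex_of_real ` {a..b + \<eta>})) (\<lambda>t. K1 (of_real t))"
          by (simp add: image_image)
        then have "continuous_on (complex_of_real ` {a..b + \<eta>}) (\<lambda>w. K1 (of_real (Re w)))"
          by (intro continuous_on_compose2[where g = "\<lambda>t. K1 (of_real t)" and f = Re]) (auto intro!: continuous_intros)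
        then show "continuous_on (complex_of_real ` {a..b + \<eta>}) K1"
          by (rule continuous_on_eq) auto
        show "w + complex_of_real \<sigma> \<in> complex_of_real ` {a..b + \<eta>}"
          if "w \<in> {w \<in> R. Im w = 0}" "\<sigma> \<in> {0..s n}" for w n \<sigma>
          using that s(3)[of n]
          by (intro image_eqI[of _ _ "Re w + \<sigma>"]) (auto simp: R_def in_cbox_complex_iff complex_eq_iff)
        show "((\<lambda>x. K (Complex x (Im w))) has_vector_derivative K1 w) (at (Re w))"
          if "w \<in> complex_of_real ` {a..b + \<eta>}" for w
          using that ab \<eta> by (intro hder) (auto simp: U_def)
      qed (use s in auto)
      from uniform_limitD[OF this, of "e / c^4"]
      have ev_bot: "\<forall>\<^sub>F n in sequentially. \<forall>w\<in>{w \<in> R. Im w = 0}. dist (Q n w) (K1 w) < e / c^4"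
        using e c by simp
      have "uniform_limit {w \<in> R. Im w \<ge> \<delta>} Q K1 sequentially"
        unfolding Q_def
      proof (rule uniform_limit_horizontal_quotient[where X = "cbox (Complex a \<delta>) (Complex (b + \<eta>) 1)"])
        show "continuous_on (cbox (Complex a \<delta>) (Complex (b + \<eta>) 1)) K1"
          using ab \<eta> \<delta> by (intro continuous_on_subset[OF contV]) (auto simp: V_def in_cbox_complex_iff)
        show "w + complex_of_real \<sigma> \<in> cbox (Complex a \<delta>) (Complex (b + \<eta>) 1)"
          if "w \<in> {w \<in> R. Im w \<ge> \<delta>}" "\<sigma> \<in> {0..s n}" for w n \<sigma>
          using that s(3)[of n] by (auto simp: R_def in_cbox_complex_iff)
        show "((\<lambda>x. K (Complex x (Im w))) has_vector_derivative K1 w) (at (Re w))"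
          if "w \<in> cbox (Complex a \<delta>) (Complex (b + \<eta>) 1)" for w
          using that ab \<eta> \<delta> by (intro hder) (auto simp: U_def in_cbox_complex_iff)
      qed (use s in auto)
      from uniform_limitD[OF this, of "e / c^4"]
      have ev_top: "\<forall>\<^sub>F n in sequentially. \<forall>w\<in>{w \<in> R. Im w \<ge> \<delta>}. dist (Q n w) (K1 w) < e / c^4"
        using e c by simp
      show "\<forall>\<^sub>F n in sequentially. \<forall>w\<in>frontier R. dist (P w * Q n w) (P w * K1 w) < e"
        using ev_bot ev_top
      proof eventually_elim
        case (elim n)
        show ?case
        proof
          fix w assume "w \<in> frontier R"
          then have w: "w \<in> R" "w \<notin> box (Complex a 0) (Complex b 1)"
            by (auto simp: R_def frontier_cbox)
          have dist_eq: "dist (P w * Q n w) (P w * K1 w) = norm (P w) * norm (Q n w - K1 w)"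
            by (simp add: dist_norm norm_mult flip: right_diff_distrib)
          show "dist (P w * Q n w) (P w * K1 w) < e"
          proof (cases "Im w = 0 \<or> Im w \<ge> \<delta>")
            case True
            then have "norm (Q n w - K1 w) < e / c^4"
              using elim w by (auto simp: dist_norm)
            then have "norm (P w) * norm (Q n w - K1 w) \<le> c^4 * norm (Q n w - K1 w)"
              "c^4 * norm (Q n w - K1 w) < e"
              using P_le[OF w(1)] c by (auto simp: field_simps intro: mult_right_mono)
            then show ?thesis using dist_eq by simp
          next
            case False
            then have y: "0 < Im w" "Im w < \<delta>" and side: "Re w = a \<or> Re w = b"
              using w \<delta> by (auto simp: R_def in_cbox_complex_iff in_box_complex_iff)
            have "norm (P w) * norm (Q n w - K1 w) \<le> (c * Im w)^2 * (2 * B / Im w)"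
              using P_side[OF w(1) side] Q_near[OF w(1) y(1)] by (intro mult_mono) auto
            also have "\<dots> = 2 * c^2 * B * Im w"
              using y by (simp add: field_simps power2_eq_square)
            also have "\<dots> \<le> 2 * c^2 * B * \<delta>"
              using y B c by (intro mult_left_mono) auto
            finally show ?thesis using dist_eq \<delta> by simp
          qed
        qed
      qed
    qed
    have cont_PQ: "continuous_on R (\<lambda>w. P w * Q n w)" for n
    proof -
      have "(\<lambda>w. w + of_real (s n)) ` R \<subseteq> U" "R \<subseteq> U"
        using RU[of _ "s n" n] RU[of _ 0 n] s(1)[of n] by auto
      then have "continuous_on R (\<lambda>w. K (w + of_real (s n)))" "continuous_on R K"
        unfolding U_def
        by (auto intro!: continuous_on_compose2[OF cont] continuous_intros intro: continuous_on_subset[OF cont])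
      then show ?thesis
        unfolding P_def Q_def using s(1)[of n] by (auto intro!: continuous_intros)
    qed
    have intR: "interior R = box (Complex a 0) (Complex b 1)"
      by (simp add: R_def interior_cbox)
    have hol_PQ: "(\<lambda>w. P w * Q n w) holomorphic_on interior R" for n
    proof -
      have sub: "(\<lambda>w. w + of_real (s n)) ` interior R \<subseteq> V" "interior R \<subseteq> V"
        using ab \<eta> s(1)[of n] s(3)[of n] by (auto simp: V_def intR in_box_complex_iff)
      have "(K \<circ> (\<lambda>w. w + of_real (s n))) holomorphic_on interior R"
        by (rule holomorphic_on_compose_gen[OF _ holK sub(1)]) (intro holomorphic_intros)
      moreover have "K holomorphic_on interior R"
        using holK sub(2) by (rule holomorphic_on_subset)
      ultimately show ?thesis
        unfolding P_def Q_def o_def using s(1)[of n] by (auto intro!: holomorphic_intros)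
    qed
    have "uniformly_convergent_on R (\<lambda>n w. P w * Q n w)"
      using lim_frontier cont_PQ hol_PQ
      by (intro uniformly_convergent_on_of_frontier) (auto simp: R_def)
    then obtain L where L: "uniform_limit R (\<lambda>n w. P w * Q n w) L sequentially"
      by (auto simp: uniformly_convergent_on_def)
    have "continuous_on R L"
      using cont_PQ by (intro uniform_limit_theorem[OF _ L] always_eventually) auto
    \<comment> \<open>The limit is identified pointwise: inside the box by complex differentiability
      of \<open>K\<close>, on the frontier by \<open>lim_frontier\<close>.\<close>
    moreover have "L w = P w * K1 w" if w: "w \<in> R" for w
    proof (rule LIMSEQ_unique)
      show "(\<lambda>n. P w * Q n w) \<longlonglongrightarrow> L w"
        using L w by (rule tendsto_uniform_limitI)
      show "(\<lambda>n. P w * Q n w) \<longlonglongrightarrow> P w * K1 w"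
      proof (cases "w \<in> box (Complex a 0) (Complex b 1)")
        case True
        then have "(K has_field_derivative K1 w) (at w)"
          using ab by (intro der) (auto simp: in_box_complex_iff)
        then have "((\<lambda>h. (K (w + h) - K w) / h) \<longlongrightarrow> K1 w) (at 0)"
          by (simp add: DERIV_def)
        moreover have "filterlim (\<lambda>n. complex_of_real (s n)) (at 0) sequentially"
          using s(1) tendsto_of_real[OF s(2), where 'a = complex]
          by (auto simp: filterlim_at less_imp_neq[symmetric] intro!: always_eventually)
        ultimately have "(\<lambda>n. Q n w) \<longlonglongrightarrow> K1 w"
          unfolding Q_def by (rule filterlim_compose)
        then show ?thesis by (intro tendsto_intros)
      next
        case False
        then have "w \<in> frontier R" using w by (auto simp: R_def frontier_cbox)
        with lim_frontier show ?thesis by (rule tendsto_uniform_limitI)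
      qed
    qed
    ultimately show ?thesis
      unfolding R_def P_def by (metis (no_types, lifting) continuous_on_cong)
  qed
  have "continuous (at w within U) K1" if w: "w \<in> U" for w
  proof (cases "Im w = 0")
    case False
    then have "isCont K1 w"
      using contV \<open>open V\<close> w by (auto simp: continuous_on_eq_continuous_at U_def V_def)
    then show ?thesis by (rule continuous_at_imp_continuous_at_within)
  next
    case True
    obtain a b where ab: "\<alpha> < a" "a < Re w" "Re w < b" "b < \<beta>"
      using w dense[of \<alpha> "Re w"] dense[of "Re w" \<beta>] by (auto simp: U_def)
    \<comment> \<open>On \<open>W\<close> the factor has no zeros and can be divided out. As
      \<open>W\<close> is open, continuity at \<open>w\<close> within \<open>U \<inter> W\<close> is
      the same as within \<open>U\<close>.\<close>
    define W where "W = {z. a < Re z \<and> Re z < b \<and> Im z < 1}"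
    have "open W"
      unfolding W_def by (intro open_Collect_conj open_Collect_less continuous_intros)
    have "w \<in> W" using ab True by (simp add: W_def)
    have "continuous_on (U \<inter> W) (\<lambda>z. ((z - of_real a) * (z - of_real b))^2 * K1 z)"
      using ab by (intro continuous_on_subset[OF box_cont[of a b]])
        (auto simp: U_def W_def in_cbox_complex_iff)
    then have "continuous_on (U \<inter> W)
        (\<lambda>z. ((z - of_real a) * (z - of_real b))^2 * K1 z / ((z - of_real a) * (z - of_real b))^2)"
      by (rule continuous_on_divide) (auto simp: W_def intro!: continuous_intros)
    then have "continuous_on (U \<inter> W) K1"
      by (rule continuous_on_eq) (auto simp: W_def)
    then have "continuous (at w within (U \<inter> W)) K1"
      using w \<open>w \<in> W\<close> by (auto simp: continuous_on_eq_continuous_within)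
    also have "at w within (U \<inter> W) = at w within U"
      using \<open>w \<in> W\<close> \<open>open W\<close> by (intro at_within_nhd[where S = W]) auto
    finally show ?thesis .
  qed
  then show ?thesis
    unfolding U_def continuous_on_eq_continuous_within by blast
qed

section \<open>From the half-strip to the disc\<close>

text \<open>The map \<open>exp (\<i> * w)\<close> takes the upper half-plane into the disc and the
  real interval onto the arc. The strip result applies to the pullback, and
  \<open>- \<i> * Ln z\<close> leads back.\<close>

proposition deriv_extends_of_boundary_C1:
  assumes hol: "h holomorphic_on ball 0 1"
    and ext: "continuous_extension (ball 0 1) h disc_with_arc H"
    and bdy: "\<And>t. t \<in> {0<..<1} \<Longrightarrow> ((\<lambda>t. H (cis t)) has_vector_derivative G' t) (at t)"
    and contG': "continuous_on {0<..<1} G'"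
  obtains F where "continuous_extension (ball 0 1) (deriv h) disc_with_arc F"
proof -
  let ?U = "{w. 0 < Re w \<and> Re w < 1 \<and> 0 \<le> Im w}"
  have contH: "continuous_on disc_with_arc H" and Hh: "\<And>z. z \<in> ball 0 1 \<Longrightarrow> H z = h z"
    using ext by (auto simp: continuous_extension_def)
  define K where "K = (\<lambda>w. H (exp (\<i> * w)))"
  \<comment> \<open>Above the axis this is the chain rule; on the axis the given derivative along
    the arc takes over.\<close>
  define K1 where "K1 = (\<lambda>w. if 0 < Im w then \<i> * exp (\<i> * w) * deriv h (exp (\<i> * w)) else G' (Re w))"
  have exp_real: "exp (\<i> * of_real x) = cis x" for x
    by (simp add: cis_conv_exp)
  have exp_disc: "exp (\<i> * w) \<in> ball 0 1" if "0 < Im w" for w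
    using that by simp
  have exp_arc: "exp (\<i> * w) \<in> disc_with_arc" if "w \<in> ?U" for w
  proof (cases "Im w = 0")
    case True
    then have "w = of_real (Re w)" by (simp add: complex_eq_iff)
    then have "exp (\<i> * w) = cis (Re w)" by (metis exp_real)
    then show ?thesis using that by (auto simp: disc_with_arc_def)
  next
    case False
    then show ?thesis using that exp_disc[of w] by (auto simp: disc_with_arc_def)
  qed
  have contK1: "continuous_on ?U K1"
  proof (rule continuous_on_strip_derivative)
    show "continuous_on ?U K"
      unfolding K_def using exp_arc
      by (intro continuous_on_compose2[OF contH]) (auto intro!: continuous_intros)
    show "(K has_field_derivative K1 w) (at w)" if w: "0 < Im w" for w
    proof -
      have "((\<lambda>w. exp (\<i> * w)) has_field_derivative \<i> * exp (\<i> * w)) (at w)"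
        by (auto intro!: derivative_eq_intros)
      moreover have "(h has_field_derivative deriv h (exp (\<i> * w))) (at (exp (\<i> * w)))"
        using hol exp_disc[OF w] by (intro holomorphic_derivI[where S = "ball 0 1"]) auto
      ultimately have "((\<lambda>w. h (exp (\<i> * w))) has_field_derivative K1 w) (at w)"
        using w by (auto simp: K1_def mult.commute dest: DERIV_chain2[rotated])
      moreover have "open {w. 0 < Im w}"
        by (intro open_Collect_less continuous_intros)
      ultimately show ?thesis
        by (rule has_field_derivative_transform_within_open)
          (use w exp_disc in \<open>auto simp: K_def Hh\<close>)
    qed
    show "((\<lambda>x. K (of_real x)) has_vector_derivative K1 (of_real t)) (at t)" if "0 < t" "t < 1" for t
      using bdy[of t] that by (simp add: K_def K1_def exp_real)
    show "continuous_on {0<..<1} (\<lambda>t. K1 (of_real t))"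
      using contG' by (simp add: K1_def)
  qed
  define A where "A = {z. 0 < Re z}"
  \<comment> \<open>An open neighbourhood of the arc on which the principal logarithm is continuous:
    angles below 1 lie in the right half-plane.\<close>
  define W where "W = A \<inter> (\<lambda>z. Im (Ln z)) -` {0<..<1}"
  have contLn: "continuous_on A Ln"
    by (intro continuous_intros) (auto simp: A_def complex_nonpos_Reals_iff)
  have "open A"
    unfolding A_def by (intro open_Collect_less continuous_intros)
  then have "open W"
    unfolding W_def by (intro continuous_open_preimage continuous_intros contLn) auto
  have Ln_U: "- \<i> * Ln z \<in> ?U" "0 < Im (- \<i> * Ln z) \<longleftrightarrow> z \<in> ball 0 1"
    if "z \<in> disc_with_arc" "z \<in> W" for z
  proof -
    have "z \<noteq> 0" using that(2) by (auto simp: W_def A_def)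
    moreover have "norm z \<le> 1" using that(1) by (auto simp: disc_with_arc_def)
    ultimately show "- \<i> * Ln z \<in> ?U" "0 < Im (- \<i> * Ln z) \<longleftrightarrow> z \<in> ball 0 1"
      using that(2) by (auto simp: W_def)
  qed
  \<comment> \<open>The value on the arc comes from solving \<open>K1 w = \<i> * z * F z\<close>
    with \<open>z = exp (\<i> * w)\<close>.\<close>
  define F where "F = (\<lambda>z. if z \<in> ball 0 1 then deriv h z else K1 (- \<i> * Ln z) / (\<i> * z))"
  \<comment> \<open>The arc formula also holds in the disc part of \<open>W\<close>, so near the arc
    \<open>F\<close> is a single composition of continuous maps.\<close>
  have F_eq: "F z = K1 (- \<i> * Ln z) / (\<i> * z)" if "z \<in> disc_with_arc" "z \<in> W" for z
  proof (cases "z \<in> ball 0 1")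
    case True
    have "z \<noteq> 0" using that by (auto simp: W_def A_def)
    moreover have "exp (\<i> * (- \<i> * Ln z)) = z"
      using \<open>z \<noteq> 0\<close> by (simp flip: mult.assoc)
    moreover have "0 < Im (- \<i> * Ln z)"
      using Ln_U(2)[OF that] True by blast
    ultimately have "K1 (- \<i> * Ln z) = \<i> * z * deriv h z"
      unfolding K1_def by (simp only: if_True)
    then show ?thesis using True \<open>z \<noteq> 0\<close> by (simp add: F_def)
  qed (simp add: F_def)
  have contFW: "continuous_on (disc_with_arc \<inter> W) F"
  proof -
    have "continuous_on (disc_with_arc \<inter> W) (\<lambda>z. K1 (- \<i> * Ln z))"
    proof (rule continuous_on_compose2[OF contK1])
      show "continuous_on (disc_with_arc \<inter> W) (\<lambda>z. - \<i> * Ln z)"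
        by (intro continuous_intros continuous_on_subset[OF contLn]) (auto simp: W_def)
    qed (use Ln_U in blast)
    then have "continuous_on (disc_with_arc \<inter> W) (\<lambda>z. K1 (- \<i> * Ln z) / (\<i> * z))"
      by (rule continuous_on_divide) (auto simp: W_def A_def intro!: continuous_intros)
    then show ?thesis
      by (rule continuous_on_eq) (use F_eq in auto)
  qed
  have "continuous (at z within disc_with_arc) F" if z: "z \<in> disc_with_arc" for z
  proof (cases "z \<in> ball 0 1")
    case True
    have "continuous_on (ball 0 1) (deriv h)"
      using hol by (intro holomorphic_on_imp_continuous_on holomorphic_deriv) auto
    then have "continuous_on (ball 0 1) F"
      by (rule continuous_on_eq) (auto simp: F_def)
    then have "isCont F z"
      using True by (auto simp: continuous_on_eq_continuous_at)
    then show ?thesis by (rule continuous_at_imp_continuous_at_within)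
  next
    case False
    then obtain t where t: "0 < t" "t < 1" "z = cis t"
      using z by (auto simp: disc_with_arc_def)
    have "Ln z = \<i> * of_real t"
      using t pi_gt3 by (simp add: Ln_exp cis_conv_exp)
    moreover have "Re z > 0"
      using t pi_gt3 by (simp add: cos_gt_zero)
    ultimately have "z \<in> W"
      using t by (simp add: W_def A_def)
    then have "continuous (at z within (disc_with_arc \<inter> W)) F"
      using contFW z by (auto simp: continuous_on_eq_continuous_within)
    also have "at z within (disc_with_arc \<inter> W) = at z within disc_with_arc"
      using \<open>z \<in> W\<close> \<open>open W\<close> by (intro at_within_nhd[where S = W]) auto
    finally show ?thesis .
  qed
  then have "continuous_extension (ball 0 1) (deriv h) disc_with_arc F"
    by (auto simp: continuous_extension_def continuous_on_eq_continuous_within F_def disc_with_arc_def)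
  then show thesis by (rule that)
qed

section \<open>The derivative along the arc\<close>

text \<open>Near \<open>z = cis t\<close> the function \<open>h u - F z * u\<close> has derivative
  of norm at most \<open>e\<close> in the disc, so the mean value inequality holds there. Radial
  contraction and continuity of \<open>H\<close> extend it to the arc; the chain rule along
  \<open>cis\<close> finishes.\<close>

lemma has_vector_derivative_boundary:
  assumes hol: "h holomorphic_on ball 0 1"
    and extH: "continuous_extension (ball 0 1) h disc_with_arc H"
    and extF: "continuous_extension (ball 0 1) (deriv h) disc_with_arc F"
    and t: "t \<in> {0<..<1}"
  shows "((\<lambda>t. H (cis t)) has_vector_derivative \<i> * cis t * F (cis t)) (at t)"
proof -
  let ?E = disc_with_arc
  \<comment> \<open>Factors in \<open>[0, 1)\<close> tending to 1; they move points of
    \<open>disc_with_arc\<close> into the open disc.\<close>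
  let ?r = "\<lambda>n. complex_of_real (1 - inverse (real (Suc n)))"
  define z where "z = cis t"
  have zE: "z \<in> ?E" using t by (auto simp: z_def disc_with_arc_def)
  have r_lim: "(\<lambda>n. ?r n * w) \<longlonglongrightarrow> w" for w
  proof -
    have "(\<lambda>n. ?r n * w) \<longlonglongrightarrow> complex_of_real (1 - 0) * w"
      by (intro tendsto_intros LIMSEQ_inverse_real_of_nat)
    then show ?thesis by simp
  qed
  have r_disc: "?r n * w \<in> ball 0 1" if "w \<in> ?E" for n w
  proof -
    have "norm (?r n) < 1" "norm w \<le> 1"
      using that unfolding norm_of_real by (auto simp: disc_with_arc_def field_simps)
    then have "norm (?r n) * norm w < 1"
      by (metis mult.right_neutral mult_left_mono norm_ge_zero order_le_less_trans)
    then show ?thesis by (simp add: norm_mult)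
  qed
  have sub: "ball 0 1 \<subseteq> ?E" by (auto simp: disc_with_arc_def)
  have H_lim: "(\<lambda>n. H (?r n * w)) \<longlonglongrightarrow> H w" if "w \<in> ?E" for w
    using extH that r_disc[OF that] sub
    by (intro continuous_on_tendsto_compose[OF _ r_lim])
      (auto simp: continuous_extension_def intro!: always_eventually)
  have "(H has_derivative (*) (F z)) (at z within ?E)"
    unfolding has_derivative_within_alt
  proof (intro conjI allI impI)
    show "bounded_linear ((*) (F z))" by (rule bounded_linear_mult_right)
    fix e :: real assume e: "e > 0"
    obtain d where d: "d > 0" "\<And>w. w \<in> ?E \<Longrightarrow> dist w z < d \<Longrightarrow> dist (F w) (F z) < e"
      using extF zE e unfolding continuous_extension_def continuous_on_iff by metis
    have "norm (H w - H z - F z * (w - z)) \<le> e * norm (w - z)" if w: "w \<in> ?E" "norm (w - z) < d" for w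
    proof (rule tendsto_le)
      \<comment> \<open>Both contracted points eventually lie in this convex set, where
        \<open>h\<close> is holomorphic and \<open>deriv h\<close> is within \<open>e\<close> of
        \<open>F z\<close>.\<close>
      let ?S = "ball 0 1 \<inter> ball z d"
      show "(\<lambda>n. norm (H (?r n * w) - H (?r n * z) - F z * (?r n * w - ?r n * z)))
          \<longlonglongrightarrow> norm (H w - H z - F z * (w - z))"
        by (intro tendsto_intros r_lim H_lim w zE)
      show "(\<lambda>n. e * norm (?r n * w - ?r n * z)) \<longlonglongrightarrow> e * norm (w - z)"
        by (intro tendsto_intros r_lim)
      have ev: "\<forall>\<^sub>F n in sequentially. ?r n * u \<in> ball z d" if "u \<in> ball z d" for u
        using topological_tendstoD[OF r_lim open_ball that] .
      have "\<forall>\<^sub>F n in sequentially. ?r n * w \<in> ball z d" "\<forall>\<^sub>F n in sequentially. ?r n * z \<in> ball z d"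
        using ev[of w] ev[of z] w d by (auto simp: dist_norm norm_minus_commute)
      then show "\<forall>\<^sub>F n in sequentially.
          norm (H (?r n * w) - H (?r n * z) - F z * (?r n * w - ?r n * z)) \<le> e * norm (?r n * w - ?r n * z)"
      proof eventually_elim
        case (elim n)
        have "norm ((h (?r n * w) - F z * (?r n * w)) - (h (?r n * z) - F z * (?r n * z)))
            \<le> e * norm (?r n * w - ?r n * z)"
        proof (rule field_differentiable_bound[where S = ?S and f' = "\<lambda>u. deriv h u - F z"])
          show "convex ?S" by (intro convex_Int convex_ball)
          show "((\<lambda>u. h u - F z * u) has_field_derivative deriv h u - F z) (at u within ?S)"
            if "u \<in> ?S" for u
            using that holomorphic_derivI[OF hol, of u]
            by (auto intro!: derivative_eq_intros intro: has_field_derivative_at_within)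
          show "norm (deriv h u - F z) \<le> e" if "u \<in> ?S" for u
          proof -
            have "dist (F u) (F z) < e"
              using that sub by (intro d(2)) (auto simp: dist_commute)
            moreover have "F u = deriv h u"
              using that extF by (auto simp: continuous_extension_def)
            ultimately show ?thesis by (simp add: dist_norm)
          qed
        qed (use elim r_disc w zE in auto)
        moreover have "H (?r n * w) = h (?r n * w)" "H (?r n * z) = h (?r n * z)"
          using extH r_disc[OF w(1)] r_disc[OF zE] unfolding continuous_extension_def by blast+
        ultimately show ?case by (simp add: algebra_simps)
      qed
    qed simp
    then show "\<exists>d>0. \<forall>w\<in>?E. norm (w - z) < d \<longrightarrow> norm (H w - H z - F z * (w - z)) \<le> e * norm (w - z)"
      using d(1) by blast
  qed
  then have "(H has_field_derivative F (cis t)) (at (cis t) within cis ` {0<..<1})"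
    unfolding has_field_derivative_def z_def
    by (rule has_derivative_subset) (auto simp: disc_with_arc_def)
  moreover have "(cis has_vector_derivative \<i> * cis t) (at t within {0<..<1})"
    unfolding cis_conv_exp[abs_def]
    by (auto intro!: derivative_eq_intros has_vector_derivative_real_field)
  ultimately have "((H \<circ> cis) has_vector_derivative \<i> * cis t * F (cis t)) (at t within {0<..<1})"
    by (intro field_vector_diff_chain_within) auto
  then show ?thesis
    using t by (simp add: o_def at_within_open[OF t])
qed

section \<open>Calculus of \<open>C_on\<close>\<close>

text \<open>Reduces infinite \<open>p\<close> to finite orders. Differentiability of the
  \<open>k\<close>-th derivative is read off at order \<open>Suc k\<close>, its continuity at order
  \<open>k\<close>.\<close>

lemma C_on_iff_nat: "C_on p S g \<longleftrightarrow> (\<forall>n. enat n \<le> p \<longrightarrow> C_on (enat n) S g)"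
proof
  assume g: "C_on p S g"
  show "\<forall>n. enat n \<le> p \<longrightarrow> C_on (enat n) S g"
    using g unfolding C_on_def by (meson order_less_le_trans order_trans)
next
  assume g: "\<forall>n. enat n \<le> p \<longrightarrow> C_on (enat n) S g"
  have "C_on (enat (Suc k)) S g" if "enat k < p" for k
    using g that by (simp add: Suc_ile_eq)
  then show "C_on p S g"
    using g unfolding C_on_def by (meson enat_ord_simps(2) lessI order_refl)
qed

lemma C_on_0: "C_on (enat 0) S g \<longleftrightarrow> continuous_on S g"
  by (auto simp: C_on_def)

text \<open>On an open set the values on \<open>S\<close> determine all iterated derivatives there.
  This is needed because functions are known only on the interval.\<close>

lemma C_on_cong:
  assumes "open S" and eq: "\<And>t. t \<in> S \<Longrightarrow> f t = g t"
  shows "C_on p S f \<longleftrightarrow> C_on p S g"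
proof -
  let ?D = "\<lambda>h t. vector_derivative h (at t)"
  have D: "\<forall>t\<in>S. (?D ^^ k) f t = (?D ^^ k) g t" for k
  proof (induction k)
    case (Suc k)
    show ?case
    proof
      fix t assume "t \<in> S"
      then have "\<forall>\<^sub>F x in nhds t. (?D ^^ k) f x = (?D ^^ k) g x"
        using Suc \<open>open S\<close> by (auto simp: eventually_nhds)
      then show "(?D ^^ Suc k) f t = (?D ^^ Suc k) g t"
        by (auto intro!: vector_derivative_cong_eq elim: eventually_mono)
    qed
  qed (use eq in auto)
  have transfer: "v differentiable at t"
    if "u differentiable at t" "t \<in> S" "\<forall>t\<in>S. u t = v t" for u v :: "real \<Rightarrow> complex" and t
    using that \<open>open S\<close> unfolding differentiable_def
    by (blast intro: has_derivative_transform_within_open)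
  have diff: "(?D ^^ k) f differentiable at t \<longleftrightarrow> (?D ^^ k) g differentiable at t" if "t \<in> S" for k t
    using transfer[OF _ that, of "(?D ^^ k) f" "(?D ^^ k) g"]
      transfer[OF _ that, of "(?D ^^ k) g" "(?D ^^ k) f"] D[of k] by auto
  have "continuous_on S ((?D ^^ k) f) \<longleftrightarrow> continuous_on S ((?D ^^ k) g)" for k
    using D[of k] by (intro continuous_on_cong) auto
  with diff show ?thesis
    by (simp add: C_on_def)
qed

lemma funpow_vector_derivative_Suc:
  fixes g :: "real \<Rightarrow> complex"
  shows "((\<lambda>h t. vector_derivative h (at t)) ^^ Suc k) g
    = ((\<lambda>h t. vector_derivative h (at t)) ^^ k) (\<lambda>t. vector_derivative g (at t))"
  by (simp only: funpow_Suc_right o_apply)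

text \<open>Peels off the innermost derivative, the form suited to induction on the order. The
  witness \<open>g'\<close> is free off \<open>S\<close>, so explicit formulas can be used instead
  of \<open>vector_derivative\<close>.\<close>

lemma C_on_Suc:
  assumes "open S"
  shows "C_on (enat (Suc n)) S g \<longleftrightarrow>
    (\<exists>g'. (\<forall>t\<in>S. (g has_vector_derivative g' t) (at t)) \<and> C_on (enat n) S g')"
proof
  let ?D = "\<lambda>h t. vector_derivative h (at t)"
  assume g: "C_on (enat (Suc n)) S g"
  have "C_on (enat n) S (?D g)"
    unfolding C_on_def
  proof (intro conjI allI impI)
    fix k
    show "\<forall>t\<in>S. (?D ^^ k) (?D g) differentiable at t" if "enat k < enat n"
      using g that funpow_vector_derivative_Suc[of k g] unfolding C_on_def by (metis Suc_less_eq enat_ord_simps(2))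
    show "continuous_on S ((?D ^^ k) (?D g))" if "enat k \<le> enat n"
      using g that funpow_vector_derivative_Suc[of k g] unfolding C_on_def by (metis Suc_le_mono enat_ord_simps(1))
  qed
  moreover have "\<forall>t\<in>S. (g has_vector_derivative ?D g t) (at t)"
    using g by (auto simp: C_on_def vector_derivative_works[symmetric] dest!: spec[of _ 0])
  ultimately show "\<exists>g'. (\<forall>t\<in>S. (g has_vector_derivative g' t) (at t)) \<and> C_on (enat n) S g'"
    by (intro exI[of _ "?D g"]) blast
next
  let ?D = "\<lambda>h t. vector_derivative h (at t)"
  assume "\<exists>g'. (\<forall>t\<in>S. (g has_vector_derivative g' t) (at t)) \<and> C_on (enat n) S g'"
  then obtain g' where der: "\<And>t. t \<in> S \<Longrightarrow> (g has_vector_derivative g' t) (at t)"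
    and "C_on (enat n) S g'" by blast
  moreover have "g' t = ?D g t" if "t \<in> S" for t
    using der[OF that] by (simp add: vector_derivative_at)
  ultimately have D: "C_on (enat n) S (?D g)"
    using C_on_cong[OF \<open>open S\<close>, of g' "?D g" "enat n"] by simp
  have diff: "\<forall>t\<in>S. g differentiable at t"
    using der by (auto simp: differentiable_def has_vector_derivative_def)
  then have cont: "continuous_on S g"
    by (meson continuous_at_imp_continuous_on differentiable_imp_continuous_within)
  show "C_on (enat (Suc n)) S g"
    unfolding C_on_def
  proof (intro conjI allI impI)
    fix k
    show "\<forall>t\<in>S. (?D ^^ k) g differentiable at t" if "enat k < enat (Suc n)"
      using D diff that by (cases k) (auto simp: C_on_def funpow_vector_derivative_Suc simp del: funpow.simps(2))
    show "continuous_on S ((?D ^^ k) g)" if "enat k \<le> enat (Suc n)"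
      using D cont that by (cases k) (auto simp: C_on_def funpow_vector_derivative_Suc simp del: funpow.simps(2))
  qed
qed

lemma C_on_add:
  assumes "open S" "C_on (enat n) S f" "C_on (enat n) S g"
  shows "C_on (enat n) S (\<lambda>t. f t + g t)"
  using assms(2,3)
proof (induction n arbitrary: f g)
  case 0
  then show ?case by (auto simp: C_on_0 intro: continuous_on_add)
next
  case (Suc n)
  then obtain f' g' where "\<forall>t\<in>S. (f has_vector_derivative f' t) (at t)" "C_on (enat n) S f'"
    "\<forall>t\<in>S. (g has_vector_derivative g' t) (at t)" "C_on (enat n) S g'"
    unfolding C_on_Suc[OF assms(1)] by blast
  then show ?case
    unfolding C_on_Suc[OF assms(1)]
    by (intro exI[of _ "\<lambda>t. f' t + g' t"]) (auto intro!: has_vector_derivative_add Suc.IH)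
qed

lemma C_on_mult:
  assumes "open S" "C_on (enat n) S f" "C_on (enat n) S g"
  shows "C_on (enat n) S (\<lambda>t. f t * g t)"
  using assms(2,3)
proof (induction n arbitrary: f g)
  case 0
  then show ?case by (auto simp: C_on_0 intro: continuous_on_mult)
next
  case (Suc n)
  then obtain f' g' where der: "\<forall>t\<in>S. (f has_vector_derivative f' t) (at t)" "C_on (enat n) S f'"
    "\<forall>t\<in>S. (g has_vector_derivative g' t) (at t)" "C_on (enat n) S g'"
    unfolding C_on_Suc[OF assms(1)] by blast
  \<comment> \<open>The Leibniz rule multiplies derivatives by the undifferentiated factors, which
    must be lowered to class \<open>n\<close> for the induction hypothesis.\<close>
  have "C_on (enat n) S f" "C_on (enat n) S g"
    using Suc.prems C_on_iff_nat[of "enat (Suc n)"] by auto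
  with der show ?case
    unfolding C_on_Suc[OF assms(1)]
    by (intro exI[of _ "\<lambda>t. f t * g' t + f' t * g t"])
      (auto intro!: has_vector_derivative_mult C_on_add[OF assms(1)] Suc.IH)
qed

lemma C_on_exp:
  assumes "open S"
  shows "C_on (enat n) S (\<lambda>t. c * exp (d * of_real t))"
proof (induction n arbitrary: c)
  case 0
  then show ?case by (auto simp: C_on_0 intro!: continuous_intros)
next
  case (Suc n)
  have "((\<lambda>t. c * exp (d * of_real t)) has_vector_derivative c * d * exp (d * of_real t)) (at t)" for t
    by (rule has_vector_derivative_real_field) (auto intro!: derivative_eq_intros)
  with Suc show ?case
    unfolding C_on_Suc[OF assms] by (intro exI[of _ "\<lambda>t. c * d * exp (d * of_real t)"]) auto
qed

text \<open>The factor \<open>\<i> * cis t\<close> is smooth, and so is its reciprocal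
  \<open>- \<i> * exp (- \<i> * t)\<close>.\<close>

lemma C_on_cis_mult_iff:
  assumes "open S"
  shows "C_on (enat n) S (\<lambda>t. \<i> * cis t * g t) \<longleftrightarrow> C_on (enat n) S g"
proof
  assume "C_on (enat n) S (\<lambda>t. \<i> * cis t * g t)"
  then have "C_on (enat n) S (\<lambda>t. - \<i> * exp (- \<i> * of_real t) * (\<i> * cis t * g t))"
    by (rule C_on_mult[OF assms C_on_exp[OF assms]])
  moreover have "- \<i> * exp (- \<i> * of_real t) * (\<i> * cis t * g t) = g t" for t
    by (simp add: cis_conv_exp exp_minus field_simps)
  ultimately show "C_on (enat n) S g"
    by simp
next
  assume "C_on (enat n) S g"
  then have "C_on (enat n) S (\<lambda>t. \<i> * exp (\<i> * of_real t) * g t)"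
    by (rule C_on_mult[OF assms C_on_exp[OF assms]])
  then show "C_on (enat n) S (\<lambda>t. \<i> * cis t * g t)"
    by (simp add: cis_conv_exp)
qed

section \<open>Induction on the order, and the theorem\<close>

text \<open>The extension \<open>H\<close> is kept separate from \<open>h\<close> because the step
  replaces the pair by \<open>deriv h\<close> and its extension \<open>F\<close>;
  \<open>deriv h\<close> itself carries no information on the arc.\<close>

proposition derivs_extend_iff_boundary_C_on:
  assumes "h holomorphic_on ball 0 1"
    and "continuous_extension (ball 0 1) h disc_with_arc H"
  shows "(\<forall>l\<le>n. \<exists>F. continuous_extension (ball 0 1) ((deriv ^^ l) h) disc_with_arc F)
    \<longleftrightarrow> C_on (enat n) {0<..<1} (\<lambda>t. H (cis t))"
  using assms
proof (induction n arbitrary: h H)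
  case 0
  have "continuous_on {0<..<1} (\<lambda>t. H (cis t))"
  proof (rule continuous_on_compose2[where g = H and f = cis and t = disc_with_arc])
    show "continuous_on disc_with_arc H"
      using 0(2) by (simp add: continuous_extension_def)
  qed (auto simp: disc_with_arc_def intro!: continuous_intros)
  then show ?case using 0(2) by (auto simp: C_on_0)
next
  case (Suc n)
  have hol': "deriv h holomorphic_on ball 0 1"
    using Suc.prems(1) by (intro holomorphic_deriv) auto
  note bdy = has_vector_derivative_boundary[OF Suc.prems]
  show ?case
  proof
    assume ext: "\<forall>l\<le>Suc n. \<exists>F. continuous_extension (ball 0 1) ((deriv ^^ l) h) disc_with_arc F"
    obtain F where F: "continuous_extension (ball 0 1) (deriv h) disc_with_arc F"
      using ext[rule_format, of 1] by auto
    have "\<forall>l\<le>n. \<exists>F. continuous_extension (ball 0 1) ((deriv ^^ l) (deriv h)) disc_with_arc F"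
      using ext by (metis Suc_le_mono funpow_Suc_right o_apply)
    then have "C_on (enat n) {0<..<1} (\<lambda>t. \<i> * cis t * F (cis t))"
      using Suc.IH[OF hol' F] by (simp add: C_on_cis_mult_iff)
    then show "C_on (enat (Suc n)) {0<..<1} (\<lambda>t. H (cis t))"
      unfolding C_on_Suc[OF open_greaterThanLessThan] using bdy[OF F]
      by (intro exI[of _ "\<lambda>t. \<i> * cis t * F (cis t)"] conjI ballI) simp_all
  next
    assume "C_on (enat (Suc n)) {0<..<1} (\<lambda>t. H (cis t))"
    then obtain G' where G': "\<And>t. t \<in> {0<..<1} \<Longrightarrow> ((\<lambda>t. H (cis t)) has_vector_derivative G' t) (at t)"
      "C_on (enat n) {0<..<1} G'"
      unfolding C_on_Suc[OF open_greaterThanLessThan] by blast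
    have "C_on (enat 0) {0<..<1} G'"
      using G'(2) C_on_iff_nat[of "enat n"] by auto
    then have "continuous_on {0<..<1} G'"
      by (simp add: C_on_0)
    with G'(1) obtain F where F: "continuous_extension (ball 0 1) (deriv h) disc_with_arc F"
      using deriv_extends_of_boundary_C1[OF Suc.prems, of G'] by blast
    \<comment> \<open>Both sides are derivatives of the same boundary function, so the smoothness of
      \<open>G'\<close> passes to the boundary values of \<open>F\<close>.\<close>
    have "G' t = \<i> * cis t * F (cis t)" if "t \<in> {0<..<1}" for t
      using G'(1)[OF that] bdy[OF F that] by (rule vector_derivative_unique_at)
    then have "C_on (enat n) {0<..<1} (\<lambda>t. \<i> * cis t * F (cis t))"
      using G'(2) C_on_cong[OF open_greaterThanLessThan, of 0 1 G' "\<lambda>t. \<i> * cis t * F (cis t)" "enat n"]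
      by simp
    then have ext': "\<forall>l\<le>n. \<exists>F. continuous_extension (ball 0 1) ((deriv ^^ l) (deriv h)) disc_with_arc F"
      using Suc.IH[OF hol' F] by (simp add: C_on_cis_mult_iff)
    show "\<forall>l\<le>Suc n. \<exists>F. continuous_extension (ball 0 1) ((deriv ^^ l) h) disc_with_arc F"
    proof (intro allI impI)
      fix l assume "l \<le> Suc n"
      then show "\<exists>F. continuous_extension (ball 0 1) ((deriv ^^ l) h) disc_with_arc F"
        using Suc.prems(2) ext' by (cases l) (auto simp: funpow_Suc_right simp del: funpow.simps(2))
    qed
  qed
qed

text \<open>Being continuous on the closed disc, \<open>f\<close> is its own extension to the arc,
  which starts the induction. The formula is claimed for every extension \<open>F\<close> of
  \<open>deriv f\<close>; by density of the disc all of them agree on the arc.\<close>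

theorem theorem3p6:
  fixes p :: enat and f :: "complex \<Rightarrow> complex" and g :: "real \<Rightarrow> complex"
  assumes "p \<ge> 1"
    and "f \<in> disc_algebra"
    and "\<And>t. t \<in> {0<..<1} \<Longrightarrow> g t = f (cis t)"
  shows "((\<forall>l::nat. enat l \<le> p \<longrightarrow>
             (\<exists>F. continuous_extension (ball 0 1) ((deriv ^^ l) f) disc_with_arc F))
           \<longleftrightarrow> C_on p {0<..<1} g) \<and>
         (C_on p {0<..<1} g \<longrightarrow>
           (\<forall>F. continuous_extension (ball 0 1) (deriv f) disc_with_arc F \<longrightarrow>
             (\<forall>t\<in>{0<..<1}. (g has_vector_derivative \<i> * cis t * F (cis t)) (at t))))"
proof -
  let ?X = "\<lambda>l. \<exists>F. continuous_extension (ball 0 1) ((deriv ^^ l) f) disc_with_arc F"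
  have hol: "f holomorphic_on ball 0 1" and "continuous_on (cball 0 1) f"
    using assms(2) by (auto simp: disc_algebra_def)
  moreover have "disc_with_arc \<subseteq> cball 0 1"
    by (auto simp: disc_with_arc_def)
  ultimately have ext: "continuous_extension (ball 0 1) f disc_with_arc f"
    by (auto simp: continuous_extension_def disc_with_arc_def intro: continuous_on_subset)
  have "C_on (enat n) {0<..<1} g \<longleftrightarrow> (\<forall>l\<le>n. ?X l)" for n
    using derivs_extend_iff_boundary_C_on[OF hol ext, of n]
      C_on_cong[OF open_greaterThanLessThan, of 0 1 g "\<lambda>t. f (cis t)" "enat n"] assms(3) by simp
  then have "C_on p {0<..<1} g \<longleftrightarrow> (\<forall>n. enat n \<le> p \<longrightarrow> (\<forall>l\<le>n. ?X l))"
    by (subst C_on_iff_nat) simp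
  also have "\<dots> \<longleftrightarrow> (\<forall>l. enat l \<le> p \<longrightarrow> ?X l)"
    by (meson enat_ord_simps(1) order_refl order_trans)
  finally have iff: "(\<forall>l. enat l \<le> p \<longrightarrow> ?X l) \<longleftrightarrow> C_on p {0<..<1} g"
    by (rule sym)
  have "(g has_vector_derivative \<i> * cis t * F (cis t)) (at t)"
    if F: "continuous_extension (ball 0 1) (deriv f) disc_with_arc F" and t: "t \<in> {0<..<1}" for F t
    using has_vector_derivative_boundary[OF hol ext F t] open_greaterThanLessThan t
    by (rule has_vector_derivative_transform_within_open) (simp add: assms(3))
  with iff show ?thesis
    by blast
qed

end
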